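(* Let $\mathcal{R}$ be a commutative ring with unity such that $\frac12\in\mathcal{R}$, let $a,b\in\mathcal{R}$ be units, and let $\mathcal{H}^{a,b}$ be the generalized quaternion algebra over $\mathcal{R}$, regarded as a superalgebra. Then $\mathrm{BDer}_1(\mathcal{H}^{a,b})=\{0\}$, where $\mathrm{BDer}_1(\mathcal{H}^{a,b})$ denotes the set of all super-biderivations of degree $1$ of $\mathcal{H}^{a,b}$.
   Context: The generalized quaternion algebra $\mathcal{H}^{a,b}$ is the free $\mathcal{R}$-module with basis $\{1,i,j,k\}$ with the associative unital ($\mathcal{R}$-bilinear) multiplication determined by $i^2=-a$, $j^2=-b$, $k^2=-ab$, $ij=-ji=k$, $jk=-kj=bi$, $ki=-ik=aj$. It is a superalgebra ($\mathbb{Z}_2$-graded algebra) with even part $\mathcal{A}_0=\mathcal{R}\oplus\mathcal{R}i$ and odd part $\mathcal{A}_1=\mathcal{R}j\oplus\mathcal{R}k$; for $x\in\mathcal{A}_\alpha$ write $|x|=\alpha$. A super-biderivation of degree $\gamma\in\mathbb{Z}_2$ on $\mathcal{H}^{a,b}$ is an $\mathcal{R}$-bilinear map $\delta:\mathcal{H}^{a,b}\times\mathcal{H}^{a,b}\to\mathcal{H}^{a,b}$ with $\delta(\mathcal{A}_\alpha,\mathcal{A}_\beta)\subseteq\mathcal{A}_{\alpha+\beta+\gamma}$ for all $\alpha,\beta\in\mathbb{Z}_2$ such that, writing $|\delta|=\gamma$, for all homogeneous $x,y,z$: $$\delta(xy,z)=(-1)^{|\delta||x|}x\,\delta(y,z)+(-1)^{|y||z|}\delta(x,z)\,y,$$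 $$\delta(x,yz)=\delta(x,y)\,z+(-1)^{(|\delta|+|x|)|y|}\,y\,\delta(x,z).$$ *)

theory Defs
  imports Main "HOL-Library.Z2"
begin

text \<open>
  The sort \<open>{comm_ring, comm_monoid_mult}\<close> is that of commutative rings with unity, the zero
  ring included (\<open>comm_ring_1\<close> would force \<open>0 \<noteq> 1\<close>).

  \<open>Quat s t u v\<close> stands for \<open>s + t i + u j + v k\<close>. The algebra with parameters \<open>a\<close>, \<open>b\<close> is this
  type with componentwise addition, the scalar action \<open>quat_scale\<close>, and the product
  \<open>quat_mult a b\<close>.
\<close>

datatype 'r quat = Quat (quat_1: 'r) (quat_i: 'r) (quat_j: 'r) (quat_k: 'r)

instantiation quat :: (ab_group_add) ab_group_add
begin

definition zero_quat :: "'a quat" where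
  "0 = Quat 0 0 0 0"

definition plus_quat :: "'a quat \<Rightarrow> 'a quat \<Rightarrow> 'a quat" where
  "x + y = Quat (quat_1 x + quat_1 y) (quat_i x + quat_i y) (quat_j x + quat_j y) (quat_k x + quat_k y)"

definition uminus_quat :: "'a quat \<Rightarrow> 'a quat" where
  "- x = Quat (- quat_1 x) (- quat_i x) (- quat_j x) (- quat_k x)"

definition minus_quat :: "'a quat \<Rightarrow> 'a quat \<Rightarrow> 'a quat" where
  "x - y = Quat (quat_1 x - quat_1 y) (quat_i x - quat_i y) (quat_j x - quat_j y) (quat_k x - quat_k y)"

instance
  by standard
    (simp_all add: zero_quat_def plus_quat_def uminus_quat_def minus_quat_def algebra_simps)

end

definition quat_scale :: "'r::{comm_ring, comm_monoid_mult} \<Rightarrow> 'r quat \<Rightarrow> 'r quat" where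
  "quat_scale c x = Quat (c * quat_1 x) (c * quat_i x) (c * quat_j x) (c * quat_k x)"

text \<open>The bilinear extension of the multiplication table proved in \<open>quat_mult_table\<close>.\<close>

definition quat_mult ::
    "'r::{comm_ring, comm_monoid_mult} \<Rightarrow> 'r \<Rightarrow> 'r quat \<Rightarrow> 'r quat \<Rightarrow> 'r quat" where
  "quat_mult a b x y = Quat
     (quat_1 x * quat_1 y - a * (quat_i x * quat_i y) - b * (quat_j x * quat_j y)
        - a * b * (quat_k x * quat_k y))
     (quat_1 x * quat_i y + quat_i x * quat_1 y + b * (quat_j x * quat_k y - quat_k x * quat_j y))
     (quat_1 x * quat_j y + quat_j x * quat_1 y + a * (quat_k x * quat_i y - quat_i x * quat_k y))
     (quat_1 x * quat_k y + quat_k x * quat_1 y + quat_i x * quat_j y - quat_j x * quat_i y)"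

lemma quat_basis:
  fixes s :: "'r::{comm_ring, comm_monoid_mult}"
  shows "Quat s t u v = quat_scale s (Quat 1 0 0 0) + quat_scale t (Quat 0 1 0 0)
           + quat_scale u (Quat 0 0 1 0) + quat_scale v (Quat 0 0 0 1)"
  by (simp add: quat_scale_def plus_quat_def)

lemma quat_mult_table:
  fixes a b :: "'r::{comm_ring, comm_monoid_mult}"
  defines "e \<equiv> Quat 1 0 0 0" and "i \<equiv> Quat 0 1 0 0" and "j \<equiv> Quat 0 0 1 0" and "k \<equiv> Quat 0 0 0 1"
  shows "quat_mult a b e x = x" "quat_mult a b x e = x"
    "quat_mult a b i i = quat_scale (- a) e"
    "quat_mult a b j j = quat_scale (- b) e"
    "quat_mult a b k k = quat_scale (- (a * b)) e"
    "quat_mult a b i j = k" "quat_mult a b j i = - k"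
    "quat_mult a b j k = quat_scale b i" "quat_mult a b k j = - quat_scale b i"
    "quat_mult a b k i = quat_scale a j" "quat_mult a b i k = - quat_scale a j"
  by (simp_all add: e_def i_def j_def k_def quat_mult_def quat_scale_def uminus_quat_def)

lemma quat_mult_assoc:
  "quat_mult a b (quat_mult a b x y) z = quat_mult a b x (quat_mult a b y z)"
  by (simp add: quat_mult_def algebra_simps)

definition quat_bilinear ::
    "('r::{comm_ring, comm_monoid_mult} quat \<Rightarrow> 'r quat \<Rightarrow> 'r quat) \<Rightarrow> bool" where
  "quat_bilinear f \<longleftrightarrow>
     (\<forall>x y z. f (x + y) z = f x z + f y z) \<and>
     (\<forall>x y z. f x (y + z) = f x y + f x z) \<and>
     (\<forall>c x y. f (quat_scale c x) y = quat_scale c (f x y)) \<and>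
     (\<forall>c x y. f x (quat_scale c y) = quat_scale c (f x y))"

lemma quat_bilinear_mult: "quat_bilinear (quat_mult a b)"
  by (simp add: quat_bilinear_def quat_mult_def quat_scale_def plus_quat_def algebra_simps)

text \<open>Degrees live in the two-element field \<open>bit\<close>, so their sums and products are taken modulo 2.\<close>

definition quat_part :: "bit \<Rightarrow> 'r::{comm_ring, comm_monoid_mult} quat set" where
  "quat_part \<alpha> = (if \<alpha> = 0 then {Quat s t 0 0 | s t. True} else {Quat 0 0 u v | u v. True})"

lemma quat_mult_part:
  assumes "x \<in> quat_part \<alpha>" and "y \<in> quat_part \<beta>"
  shows "quat_mult a b x y \<in> quat_part (\<alpha> + \<beta>)"
  using assms by (cases \<alpha>; cases \<beta>) (auto simp: quat_part_def quat_mult_def)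

text \<open>\<open>koszul n x\<close> is \<open>(-1)\<^sup>n x\<close>.\<close>

definition koszul :: "bit \<Rightarrow> 'a::ab_group_add \<Rightarrow> 'a" where
  "koszul n x = (if n = 0 then x else - x)"

text \<open>
  Homogeneity is expressed by quantifying over degrees \<open>\<alpha>\<close>, \<open>\<beta>\<close>, \<open>\<zeta>\<close> of \<open>x\<close>, \<open>y\<close>, \<open>z\<close>. The zero
  element has both degrees, but for a bilinear map both product rules are then trivial.
\<close>

definition super_biderivation ::
    "'r::{comm_ring, comm_monoid_mult} \<Rightarrow> 'r \<Rightarrow> bit \<Rightarrow> ('r quat \<Rightarrow> 'r quat \<Rightarrow> 'r quat) \<Rightarrow> bool" where
  "super_biderivation a b \<gamma> \<delta> \<longleftrightarrow>
     quat_bilinear \<delta> \<and>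
     (\<forall>\<alpha> \<beta>. \<forall>x \<in> quat_part \<alpha>. \<forall>y \<in> quat_part \<beta>. \<delta> x y \<in> quat_part (\<alpha> + \<beta> + \<gamma>)) \<and>
     (\<forall>\<alpha> \<beta> \<zeta>. \<forall>x \<in> quat_part \<alpha>. \<forall>y \<in> quat_part \<beta>. \<forall>z \<in> quat_part \<zeta>.
        \<delta> (quat_mult a b x y) z =
          koszul (\<gamma> * \<alpha>) (quat_mult a b x (\<delta> y z)) + koszul (\<beta> * \<zeta>) (quat_mult a b (\<delta> x z) y) \<and>
        \<delta> x (quat_mult a b y z) =
          quat_mult a b (\<delta> x y) z + koszul ((\<gamma> + \<alpha>) * \<beta>) (quat_mult a b y (\<delta> x z)))"

definition BDer ::
    "bit \<Rightarrow> 'r::{comm_ring, comm_monoid_mult} \<Rightarrow> 'r \<Rightarrow> ('r quat \<Rightarrow> 'r quat \<Rightarrow> 'r quat) set" where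
  "BDer \<gamma> a b = {\<delta>. super_biderivation a b \<gamma> \<delta>}"

end

theory Submission
  imports Defs
begin

text \<open>
  Let \<open>\<delta>\<close> have degree 1. Everything vanishes at \<open>1\<close>. Since \<open>i\<close> commutes with the even part,
  \<open>0 = \<delta>(i\<^sup>2, z) = 2 i \<delta>(i, z)\<close> for odd \<open>z\<close>, hence \<open>\<delta>(i, j) = \<delta>(i, k) = 0\<close>, and similarly
  \<open>\<delta>(j, i) = \<delta>(k, i) = 0\<close>; then \<open>0 = \<delta>(i, ij) = \<delta>(i, i) j\<close> gives \<open>\<delta>(i, i) = 0\<close>. The equation
  \<open>0 = \<delta>(x, j\<^sup>2)\<close> kills the \<open>j\<close>-component of \<open>\<delta>(x, j)\<close> for \<open>x = j, k\<close>; as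
  \<open>\<delta>(k, j) = \<delta>(ij, j) = i \<delta>(j, j)\<close> and multiplication by \<open>i\<close> turns \<open>k\<close>-components into
  \<open>j\<close>-components, \<open>\<delta>(j, j) = 0\<close>. The remaining values follow from \<open>k = ij\<close>.
\<close>

lemma unit_mult_eq_0_iff:
  fixes u x :: "'r::{comm_ring, comm_monoid_mult}"
  assumes "u dvd 1"
  shows "u * x = 0 \<longleftrightarrow> x = 0"
proof -
  obtain v where "1 = u * v"
    using assms by (elim dvdE)
  then have "x = v * (u * x)"
    by (metis mult.assoc mult.commute mult_1)
  then show ?thesis
    by (metis mult_zero_right)
qed

lemma add_self_eq_0_iff:
  fixes x :: "'r::{comm_ring, comm_monoid_mult}"
  assumes "(1 + 1 :: 'r) dvd 1"
  shows "x + x = 0 \<longleftrightarrow> x = 0"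
  using unit_mult_eq_0_iff[OF assms, of x] by (simp add: distrib_right)

lemma quat_scale_0 [simp]: "quat_scale c 0 = 0"
  by (simp add: quat_scale_def zero_quat_def)

lemma quat_mult_0 [simp]: "quat_mult a b 0 x = 0" "quat_mult a b x 0 = 0"
  by (simp_all add: quat_mult_def zero_quat_def)

lemma koszul_0 [simp]: "koszul n 0 = 0"
  by (simp add: koszul_def)

lemma zero_in_quat_part: "0 \<in> quat_part \<alpha>"
  by (simp add: quat_part_def zero_quat_def)

lemma even_quatE:
  assumes "x \<in> quat_part 0"
  obtains s t where "x = Quat s t 0 0"
  using assms by (auto simp: quat_part_def)

lemma odd_quatE:
  assumes "x \<in> quat_part 1"
  obtains u v where "x = Quat 0 0 u v"
  using assms by (auto simp: quat_part_def)

text \<open>A bilinear map is determined by its values on pairs of basis elements, so the vanishing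
  of a biderivation comes down to sixteen values.\<close>

lemma quat_bilinear_eq_0I:
  fixes f :: "'r::{comm_ring, comm_monoid_mult} quat \<Rightarrow> 'r quat \<Rightarrow> 'r quat"
  defines "B \<equiv> {Quat 1 0 0 0, Quat 0 1 0 0, Quat 0 0 1 0, Quat 0 0 0 1}"
  assumes f: "quat_bilinear f" and 0: "\<And>x y. x \<in> B \<Longrightarrow> y \<in> B \<Longrightarrow> f x y = 0"
  shows "f = (\<lambda>x y. 0)"
proof (intro ext)
  fix x y :: "'r quat"
  have add: "f (p + q) r = f p r + f q r" "f p (q + r) = f p q + f p r"
    and scale: "f (quat_scale c p) q = quat_scale c (f p q)"
      "f p (quat_scale c q) = quat_scale c (f p q)" for c p q r
    using f by (auto simp: quat_bilinear_def)
  obtain s t u v where x: "x = Quat s t u v"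
    by (cases x)
  obtain s' t' u' v' where y: "y = Quat s' t' u' v'"
    by (cases y)
  have right: "f p y = 0" if "p \<in> B" for p
    unfolding y by (subst quat_basis) (use that in \<open>simp add: add scale 0 B_def\<close>)
  show "f x y = 0"
    unfolding x by (subst quat_basis) (simp add: add scale right B_def)
qed

lemma super_biderivation_zero: "super_biderivation a b \<gamma> (\<lambda>x y. 0)"
  by (simp add: super_biderivation_def quat_bilinear_def zero_in_quat_part)

lemma super_biderivation_odd_eq_0:
  fixes a b :: "'r::{comm_ring, comm_monoid_mult}"
  assumes half: "(1 + 1 :: 'r) dvd 1" and a: "a dvd 1" and b: "b dvd 1"
    and \<delta>: "super_biderivation a b 1 \<delta>"
  shows "\<delta> = (\<lambda>x y. 0)"
proof -
  define e i j k :: "'r quat"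
    where "e = Quat 1 0 0 0" and "i = Quat 0 1 0 0" and "j = Quat 0 0 1 0" and "k = Quat 0 0 0 1"
  note basis_defs = e_def i_def j_def k_def
  note [simp] = add_self_eq_0_iff[OF half] unit_mult_eq_0_iff[OF a] unit_mult_eq_0_iff[OF b]
  have bil: "quat_bilinear \<delta>"
    using \<delta> by (simp add: super_biderivation_def)
  have part: "\<delta> x y \<in> quat_part (\<alpha> + \<beta> + 1)"
    if "x \<in> quat_part \<alpha>" "y \<in> quat_part \<beta>" for x y \<alpha> \<beta>
    using \<delta> that unfolding super_biderivation_def by blast
  have left: "\<delta> (quat_mult a b x y) z =
      koszul \<alpha> (quat_mult a b x (\<delta> y z)) + koszul (\<beta> * \<zeta>) (quat_mult a b (\<delta> x z) y)"
    and right: "\<delta> x (quat_mult a b y z) =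
      quat_mult a b (\<delta> x y) z + koszul ((1 + \<alpha>) * \<beta>) (quat_mult a b y (\<delta> x z))"
    if "x \<in> quat_part \<alpha>" "y \<in> quat_part \<beta>" "z \<in> quat_part \<zeta>" for x y z \<alpha> \<beta> \<zeta>
    using \<delta> that unfolding super_biderivation_def by (metis mult_1)+
  have scale: "\<delta> (quat_scale c x) y = quat_scale c (\<delta> x y)"
    "\<delta> x (quat_scale c y) = quat_scale c (\<delta> x y)" for c x y
    using bil by (auto simp: quat_bilinear_def)
  have parts: "e \<in> quat_part 0" "i \<in> quat_part 0" "j \<in> quat_part 1" "k \<in> quat_part 1"
    by (simp_all add: quat_part_def basis_defs)
  note table = quat_mult_table[where a = a and b = b, folded basis_defs]

  \<comment> \<open>As \<open>e\<close> is even, no sign occurs: \<delta>(e, z) = \<delta>(ee, z) =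
    \<delta>(e, z) + \<delta>(e, z), and one summand cancels.\<close>
  have e1: "\<delta> e z = 0" if "z \<in> quat_part \<zeta>" for z \<zeta>
    using left[OF parts(1) parts(1) that] by (simp add: table koszul_def)
  have e2: "\<delta> x e = 0" if "x \<in> quat_part \<alpha>" for x \<alpha>
    using right[OF that parts(1) parts(1)] by (simp add: table koszul_def)
  have i_cancel: "x = 0"
    if x_even: "x \<in> quat_part 0" and "quat_mult a b i x + quat_mult a b x i = 0" for x
  proof -
    obtain s t where x: "x = Quat s t 0 0"
      using x_even by (rule even_quatE)
    \<comment> \<open>The sum is \<open>- 2 a t + 2 s i\<close>, and 2 and \<open>a\<close> are
      units.\<close>
    have "s = 0" "t = 0"
      using that(2) by (simp_all add: x i_def quat_mult_def plus_quat_def zero_quat_def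
          algebra_simps neg_eq_iff_add_eq_0 flip: minus_add_distrib)
    then show ?thesis
      by (simp add: x zero_quat_def)
  qed
  have i1: "\<delta> i z = 0" if z: "z \<in> quat_part 1" for z
  proof (rule i_cancel)
    show "\<delta> i z \<in> quat_part 0"
      using part[OF parts(2) z] by simp
    \<comment> \<open>Both signs are trivial since \<open>i\<close> is even, and \<delta>(ii, z) =
      -a \<delta>(e, z) = 0.\<close>
    show "quat_mult a b i (\<delta> i z) + quat_mult a b (\<delta> i z) i = 0"
      using left[OF parts(2) parts(2) z] by (simp add: table koszul_def scale e1[OF z])
  qed
  have i2: "\<delta> x i = 0" if x: "x \<in> quat_part 1" for x
  proof (rule i_cancel)
    show "\<delta> x i \<in> quat_part 0"
      using part[OF x parts(2)] by simp
    show "quat_mult a b i (\<delta> x i) + quat_mult a b (\<delta> x i) i = 0"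
      using right[OF x parts(2) parts(2)]
      by (simp add: table koszul_def scale e2[OF x] add.commute)
  qed
  have ii: "\<delta> i i = 0"
  proof -
    obtain u v where uv: "\<delta> i i = Quat 0 0 u v"
      using part[OF parts(2) parts(2)] by (auto elim: odd_quatE)
    have "quat_mult a b (\<delta> i i) j = 0"
      using right[OF parts(2) parts(2) parts(3)] by (simp add: table i1 parts)
    \<comment> \<open>Right multiplication by \<open>j\<close> sends \<open>u j + v k\<close> to
      \<open>- b u - b v i\<close>.\<close>
    then have "b * u = 0" "b * v = 0"
      by (simp_all add: uv j_def quat_mult_def zero_quat_def)
    then show ?thesis
      by (simp add: uv zero_quat_def)
  qed
  have j_component: "quat_j (\<delta> x j) = 0" if x: "x \<in> quat_part 1" for x
  proof -
    obtain u v where uv: "\<delta> x j = Quat 0 0 u v"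
      using part[OF x parts(3)] by (auto elim: odd_quatE)
    \<comment> \<open>The sign is + because \<open>x\<close> and \<delta> are both odd. Since
      \<open>k\<close> anticommutes with \<open>j\<close>, \<open>v\<close> drops out and only
      \<open>- 2 b u\<close> is left.\<close>
    have "quat_mult a b (\<delta> x j) j + quat_mult a b j (\<delta> x j) = 0"
      using right[OF x parts(3) parts(3)] by (simp add: table koszul_def scale e2[OF x])
    then have "u = 0"
      unfolding uv by (simp add: j_def quat_mult_def plus_quat_def zero_quat_def
          neg_eq_iff_add_eq_0 flip: minus_add_distrib)
    then show ?thesis
      by (simp add: uv)
  qed
  have kj: "\<delta> k j = quat_mult a b i (\<delta> j j)"
    using left[OF parts(2) parts(3) parts(3)] by (simp add: table koszul_def i1 parts)
  have jj: "\<delta> j j = 0"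
  proof -
    obtain u v where uv: "\<delta> j j = Quat 0 0 u v"
      using part[OF parts(3) parts(3)] by (auto elim: odd_quatE)
    have "u = 0"
      using j_component[OF parts(3)] by (simp add: uv)
    \<comment> \<open>The product of \<open>i\<close> with \<open>u j + v k\<close> has
      \<open>j\<close>-component \<open>- a v\<close>.\<close>
    moreover have "a * v = 0"
      using j_component[OF parts(4)] by (simp add: kj uv i_def quat_mult_def)
    ultimately show ?thesis
      by (simp add: uv zero_quat_def)
  qed
  \<comment> \<open>Both terms of \<delta>(x, ij) vanish, by \<open>i2\<close> and by the assumption
    on \<delta>(x, j). With \<open>x = j\<close> and \<open>x = k\<close> this gives the last two
    basis values.\<close>
  have k2: "\<delta> x k = 0" if "x \<in> quat_part 1" "\<delta> x j = 0" for x
    using right[OF that(1) parts(2) parts(3)] that by (simp add: table i2)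
  have "\<delta> x y = 0" if "x \<in> {e, i, j, k}" "y \<in> {e, i, j, k}" for x y
    using that parts by (auto simp: e1 e2 i1 i2 ii jj kj k2)
  then show ?thesis
    unfolding basis_defs by (intro quat_bilinear_eq_0I[OF bil])
qed

theorem theorem4p6:
  fixes a b :: "'r::{comm_ring, comm_monoid_mult}"
  assumes "(1 + 1 :: 'r) dvd 1" and "a dvd 1" and "b dvd 1"
  shows "BDer 1 a b = {\<lambda>x y. 0}"
  unfolding BDer_def
  by (blast intro: super_biderivation_odd_eq_0[OF assms] super_biderivation_zero)

end
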